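(* Let $R$ be a finite commutative chain ring with maximal ideal $\mathfrak{m}=\langle\theta\rangle$ and nilpotency index $\nu$, let $E$ be a finite set, let $C\le R^E$ be an $R$-code, and let $e\in E$. Suppose $C$ is contractible by $e$, and write $\mathrm{pr}_e(C)=\langle\theta^t\rangle$ with $0\le t<\nu$. Then $C$ has a generator matrix, with the column indexed by $e$ listed first, of the form $$G_0=\begin{pmatrix} u\theta^t & \mathbf{a}^\top\\ 0 & G_0'\end{pmatrix}$$ with $u\in R^\times$ and every entry of $\mathbf{a}$ in $\langle\theta^t\rangle$; and for any such $G_0$, $$M(C_{\{e\}})=M[G_0']=M(C)/\{e\}.$$
   Context: For a local ring $R$ with maximal ideal $\mathfrak{m}$: elements $v_1,\dots,v_\ell$ of an $R$-module are modular independent if $\sum\alpha_iv_i=0$ implies every $\alpha_i\in\mathfrak{m}$. For a matrix $G$ over $R$ with columns indexed by a finite set $E'$, $M[G]$ is the independence system on $E'$ whose independent sets are the $I\subseteq E'$ with $(G\text{'s columns indexed by }I)$ modular independent. An $R$-code is an $R$-submodule $C\le R^E$; a generator matrix of $C$ is a matrix whose rows form a minimal generating set of $C$; $M(C):=M[G]$ for any generator matrix $G$ (this is independent of the choice). $\mathrm{pr}_e\colon C\to R$ is the $e$-th coordinate map. The shortened code is $C_X=\{\mathbf{c}|_{E\setminus X}:\mathbf{c}\in C,\ c_i=0\ \forall i\in X\}\le R^{E\setminus X}$. $C$ is contractible by $e$ if $\mathrm{pr}_e(C)\neq\{0\}$, say $\mathrm{pr}_e(C)=\langle\theta^t\rangle$,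 and there is $\mathbf{c}\in C$ with $c_e=u\theta^t$ for some unit $u$ and $c_i\in\langle\theta^t\rangle$ for all $i\in E$. Circuits of an independence system are its minimal dependent sets. For an independence system with circuit family $\mathcal{C}$ on $E$ and an independent set $T\subseteq E$, the contraction $M/T$ is the independence system on $E\setminus T$ whose circuit family is the set of inclusion-minimal members of $\{D\setminus T: D\in\mathcal{C}\}$. *)

theory Defs
  imports Complex_Main "HOL-Library.Function_Algebras"
begin

section \<open>Chain rings\<close>

text \<open>Ideals of a commutative ring are the submodules of the regular module.\<close>

abbreviation is_ideal :: "'r::comm_ring_1 set \<Rightarrow> bool" where
  "is_ideal \<equiv> module.subspace (*)"

abbreviation principal_ideal :: "'r::comm_ring_1 \<Rightarrow> 'r set" (\<open>\<langle>_\<rangle>\<close>) where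
  "\<langle>a\<rangle> \<equiv> module.span (*) {a}"

definition maximal_ideal :: "'r::comm_ring_1 set \<Rightarrow> bool" where
  "maximal_ideal I \<longleftrightarrow> is_ideal I \<and> I \<noteq> UNIV \<and>
     (\<forall>J. is_ideal J \<longrightarrow> I \<subseteq> J \<longrightarrow> J = I \<or> J = UNIV)"

text \<open>Only meaningful for a local ring, where the maximal ideal is unique.\<close>

definition max_ideal :: "'r::comm_ring_1 set" where
  "max_ideal = (THE I. maximal_ideal I)"

definition chain_ring :: "'r::comm_ring_1 itself \<Rightarrow> bool" where
  "chain_ring _ \<longleftrightarrow> (\<forall>I J :: 'r set. is_ideal I \<longrightarrow> is_ideal J \<longrightarrow> I \<subseteq> J \<or> J \<subseteq> I)"

definition nilpotency_index :: "'r::comm_ring_1 \<Rightarrow> nat" where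
  "nilpotency_index a = (LEAST n. a ^ n = 0)"

section \<open>Independence systems\<close>

record 'e indep_system =
  ground :: "'e set"
  indep :: "'e set set"

definition independence_system :: "'e indep_system \<Rightarrow> bool" where
  "independence_system M \<longleftrightarrow> finite (ground M) \<and> indep M \<subseteq> Pow (ground M) \<and>
     {} \<in> indep M \<and> (\<forall>I\<in>indep M. \<forall>J\<subseteq>I. J \<in> indep M)"

definition minimal_members :: "'e set set \<Rightarrow> 'e set set" where
  "minimal_members F = {D \<in> F. \<forall>D'\<in>F. D' \<subseteq> D \<longrightarrow> D' = D}"

definition circuits :: "'e indep_system \<Rightarrow> 'e set set" where
  "circuits M = minimal_members {D. D \<subseteq> ground M \<and> D \<notin> indep M}"

definition system_of_circuits :: "'e set \<Rightarrow> 'e set set \<Rightarrow> 'e indep_system" where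
  "system_of_circuits E F = \<lparr>ground = E, indep = {I. I \<subseteq> E \<and> (\<forall>D\<in>F. \<not> D \<subseteq> I)}\<rparr>"

text \<open>The contraction is intended for independent \<open>T\<close>; see \<open>independence_system_contraction\<close> and
  \<open>circuits_contraction\<close> below.\<close>

definition contraction :: "'e indep_system \<Rightarrow> 'e set \<Rightarrow> 'e indep_system" where
  "contraction M T =
     system_of_circuits (ground M - T) (minimal_members {D - T |D. D \<in> circuits M})"

section \<open>Codes\<close>

text \<open>Vectors in \<open>R\<^sup>E\<close> are represented by functions on the whole index type that vanish
  outside \<open>E\<close>, so that addition is the pointwise addition of functions.\<close>

definition vecs :: "'e set \<Rightarrow> ('e \<Rightarrow> 'r::comm_ring_1) set" where
  "vecs E = {c. \<forall>i. i \<notin> E \<longrightarrow> c i = 0}"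

definition vscale :: "'r::comm_ring_1 \<Rightarrow> ('e \<Rightarrow> 'r) \<Rightarrow> 'e \<Rightarrow> 'r" where
  "vscale a c = (\<lambda>i. a * c i)"

definition vrestrict :: "'e set \<Rightarrow> ('e \<Rightarrow> 'r::comm_ring_1) \<Rightarrow> 'e \<Rightarrow> 'r" where
  "vrestrict E c = (\<lambda>i. if i \<in> E then c i else 0)"

definition is_code :: "'e set \<Rightarrow> ('e \<Rightarrow> 'r::comm_ring_1) set \<Rightarrow> bool" where
  "is_code E C \<longleftrightarrow> C \<subseteq> vecs E \<and> module.subspace vscale C"

definition pr :: "'e \<Rightarrow> ('e \<Rightarrow> 'r::comm_ring_1) \<Rightarrow> 'r" where
  "pr e c = c e"

definition shortened :: "'e set \<Rightarrow> ('e \<Rightarrow> 'r::comm_ring_1) set \<Rightarrow> 'e set \<Rightarrow> ('e \<Rightarrow> 'r) set" where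
  "shortened E C X = vrestrict (E - X) ` {c \<in> C. \<forall>i\<in>X. c i = 0}"

definition contractible ::
  "'r::comm_ring_1 \<Rightarrow> 'e set \<Rightarrow> ('e \<Rightarrow> 'r) set \<Rightarrow> 'e \<Rightarrow> bool" where
  "contractible \<theta> E C e \<longleftrightarrow> pr e ` C \<noteq> {0} \<and>
     (\<exists>t. pr e ` C = \<langle>\<theta> ^ t\<rangle> \<and>
          (\<exists>c\<in>C. (\<exists>u. u dvd 1 \<and> c e = u * \<theta> ^ t) \<and> (\<forall>i\<in>E. c i \<in> \<langle>\<theta> ^ t\<rangle>)))"

section \<open>Matrices and their independence systems\<close>

text \<open>A matrix with columns indexed by \<open>E\<close> is the list of its rows, each a vector in \<open>R\<^sup>E\<close>.
  A column is a vector indexed by the row numbers \<open>{..<length G}\<close>.\<close>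

type_synonym ('e, 'r) rowmat = "('e \<Rightarrow> 'r) list"

definition column :: "('e, 'r::comm_ring_1) rowmat \<Rightarrow> 'e \<Rightarrow> nat \<Rightarrow> 'r" where
  "column G j = (\<lambda>i. if i < length G then (G ! i) j else 0)"

definition modular_independent ::
  "('r::comm_ring_1 \<Rightarrow> 'v::ab_group_add \<Rightarrow> 'v) \<Rightarrow> 'j set \<Rightarrow> ('j \<Rightarrow> 'v) \<Rightarrow> bool" where
  "modular_independent scale J v \<longleftrightarrow>
     (\<forall>\<alpha>. (\<Sum>j\<in>J. scale (\<alpha> j) (v j)) = 0 \<longrightarrow> (\<forall>j\<in>J. \<alpha> j \<in> max_ideal))"

definition matrix_system :: "'e set \<Rightarrow> ('e, 'r::comm_ring_1) rowmat \<Rightarrow> 'e indep_system" where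
  "matrix_system E G =
     \<lparr>ground = E, indep = {I. I \<subseteq> E \<and> modular_independent vscale I (column G)}\<rparr>"

definition minimal_generating_set ::
  "('e \<Rightarrow> 'r::comm_ring_1) set \<Rightarrow> ('e \<Rightarrow> 'r) set \<Rightarrow> bool" where
  "minimal_generating_set C S \<longleftrightarrow>
     module.span vscale S = C \<and> (\<forall>S'. S' \<subset> S \<longrightarrow> module.span vscale S' \<noteq> C)"

definition generator_matrix ::
  "('e \<Rightarrow> 'r::comm_ring_1) set \<Rightarrow> ('e, 'r) rowmat \<Rightarrow> bool" where
  "generator_matrix C G \<longleftrightarrow> distinct G \<and> minimal_generating_set C (set G)"

text \<open>The choice of generator matrix is immaterial; see \<open>code_system_eq\<close> below.\<close>

definition code_system :: "'e set \<Rightarrow> ('e \<Rightarrow> 'r::comm_ring_1) set \<Rightarrow> 'e indep_system" where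
  "code_system E C = matrix_system E (SOME G. generator_matrix C G)"

text \<open>The block matrix with first row \<open>(p, a)\<close> and remaining rows \<open>(0, g)\<close> for the rows \<open>g\<close>
  of \<open>G'\<close>, where the first column has index \<open>e\<close> and \<open>a\<close>, \<open>G'\<close> have columns in \<open>E - {e}\<close>.\<close>

definition block_matrix ::
  "'e \<Rightarrow> 'r::comm_ring_1 \<Rightarrow> ('e \<Rightarrow> 'r) \<Rightarrow> ('e, 'r) rowmat \<Rightarrow> ('e, 'r) rowmat" where
  "block_matrix e p a G' = a(e := p) # map (\<lambda>g. g(e := 0)) G'"

definition pivot_form ::
  "'r::comm_ring_1 \<Rightarrow> nat \<Rightarrow> 'e set \<Rightarrow> 'e \<Rightarrow> ('e, 'r) rowmat \<Rightarrow> ('e, 'r) rowmat \<Rightarrow> bool" where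
  "pivot_form \<theta> t E e G G' \<longleftrightarrow> set G' \<subseteq> vecs (E - {e}) \<and>
     (\<exists>u a. u dvd 1 \<and> a \<in> vecs (E - {e}) \<and> (\<forall>i\<in>E - {e}. a i \<in> \<langle>\<theta> ^ t\<rangle>) \<and>
            G = block_matrix e (u * \<theta> ^ t) a G')"

section \<open>Well-definedness\<close>

lemma module_mult: "module ((*) :: 'r::comm_ring_1 \<Rightarrow> 'r \<Rightarrow> 'r)"
  by unfold_locales (simp_all add: algebra_simps)

lemma module_vscale: "module (vscale :: 'r::comm_ring_1 \<Rightarrow> ('e \<Rightarrow> 'r) \<Rightarrow> 'e \<Rightarrow> 'r)"
  by unfold_locales (simp_all add: vscale_def fun_eq_iff algebra_simps)

lemma max_ideal_eq:
  assumes "chain_ring TYPE('r::comm_ring_1)" "maximal_ideal (I :: 'r set)"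
  shows "max_ideal = I"
  unfolding max_ideal_def
proof (rule the_equality)
  show "maximal_ideal I" by (fact assms(2))
next
  fix J :: "'r set"
  assume "maximal_ideal J"
  with assms show "J = I"
    unfolding chain_ring_def maximal_ideal_def by metis
qed

lemma minimal_member_below:
  assumes "finite D" "D \<in> F"
  shows "\<exists>D'\<in>minimal_members F. D' \<subseteq> D"
  using assms
proof (induction D rule: finite_psubset_induct)
  case (psubset D)
  show ?case
  proof (cases "D \<in> minimal_members F")
    case False
    then obtain D' where "D' \<in> F" "D' \<subset> D"
      using psubset.prems by (auto simp: minimal_members_def)
    from psubset.IH[OF this(2,1)] obtain D'' where "D'' \<in> minimal_members F" "D'' \<subseteq> D'"
      by blast
    with \<open>D' \<subset> D\<close> show ?thesis by (intro bexI[of _ D'']) auto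
  next
    case True
    then show ?thesis by (intro bexI[of _ D]) auto
  qed
qed

lemma circuits_system_of_circuits:
  assumes "F \<subseteq> Pow E" "minimal_members F = F"
  shows "circuits (system_of_circuits E F) = F"
proof -
  have m: "D' = D" if "D \<in> F" "D' \<in> F" "D' \<subseteq> D" for D D'
    using that assms(2) unfolding minimal_members_def by blast
  have "{D. D \<subseteq> E \<and> D \<notin> {I. I \<subseteq> E \<and> (\<forall>D\<in>F. \<not> D \<subseteq> I)}} = {D. D \<subseteq> E \<and> (\<exists>D'\<in>F. D' \<subseteq> D)}"
    by blast
  moreover have "minimal_members {D. D \<subseteq> E \<and> (\<exists>D'\<in>F. D' \<subseteq> D)} = F"
  proof (intro equalityI subsetI)
    fix D assume "D \<in> minimal_members {D. D \<subseteq> E \<and> (\<exists>D'\<in>F. D' \<subseteq> D)}"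
    then show "D \<in> F" unfolding minimal_members_def by blast
  next
    fix D assume D: "D \<in> F"
    then have "D \<subseteq> E" using assms(1) by blast
    moreover have "D' = D" if "D' \<subseteq> D" "D'' \<in> F" "D'' \<subseteq> D'" for D' D''
      using m[OF D \<open>D'' \<in> F\<close>] that by blast
    ultimately show "D \<in> minimal_members {D. D \<subseteq> E \<and> (\<exists>D'\<in>F. D' \<subseteq> D)}"
      using D unfolding minimal_members_def by blast
  qed
  ultimately show ?thesis
    by (simp add: circuits_def system_of_circuits_def)
qed

lemma system_of_circuits_circuits:
  assumes "independence_system (M :: 'e indep_system)"
  shows "system_of_circuits (ground M) (circuits M) = M"
proof -
  have fin: "finite (ground M)" and sub: "\<And>I. I \<in> indep M \<Longrightarrow> I \<subseteq> ground M"
    and down: "\<And>I J. I \<in> indep M \<Longrightarrow> J \<subseteq> I \<Longrightarrow> J \<in> indep M"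
    using assms by (auto simp: independence_system_def)
  have "I \<subseteq> ground M \<and> (\<forall>D\<in>circuits M. \<not> D \<subseteq> I) \<longleftrightarrow> I \<in> indep M" for I
  proof
    assume I: "I \<subseteq> ground M \<and> (\<forall>D\<in>circuits M. \<not> D \<subseteq> I)"
    show "I \<in> indep M"
    proof (rule ccontr)
      assume "I \<notin> indep M"
      with I have "I \<in> {D. D \<subseteq> ground M \<and> D \<notin> indep M}" by simp
      moreover have "finite I" using I fin finite_subset by metis
      ultimately show False
        using I minimal_member_below[of I "{D. D \<subseteq> ground M \<and> D \<notin> indep M}"]
        by (simp add: circuits_def)
    qed
  next
    assume I: "I \<in> indep M"
    have "D \<notin> indep M" if "D \<in> circuits M" for D
      using that by (simp add: circuits_def minimal_members_def)
    with I sub[OF I] down[OF I] show "I \<subseteq> ground M \<and> (\<forall>D\<in>circuits M. \<not> D \<subseteq> I)"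
      by metis
  qed
  then show ?thesis by (simp add: system_of_circuits_def)
qed

lemma minimal_members_subset: "minimal_members F \<subseteq> F"
  by (simp add: minimal_members_def)

lemma minimal_members_idem: "minimal_members (minimal_members F) = minimal_members F"
  by (auto simp: minimal_members_def)

lemma independence_system_contraction:
  assumes "independence_system M" "T \<in> indep M"
  shows "independence_system (contraction M T)"
proof -
  have "\<not> D \<subseteq> T" if "D \<in> circuits M" for D
  proof
    assume "D \<subseteq> T"
    then have "D \<in> indep M" using assms unfolding independence_system_def by simp
    with that show False by (simp add: circuits_def minimal_members_def)
  qed
  then have "{} \<notin> {D - T |D. D \<in> circuits M}"
    by auto
  then have "{} \<notin> minimal_members {D - T |D. D \<in> circuits M}"
    using minimal_members_subset by blast
  moreover have "finite (ground M - T)"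
    using assms(1) by (simp add: independence_system_def)
  moreover have "independence_system (system_of_circuits E F)" if "finite E" "{} \<notin> F"
    for E :: "'a set" and F
    using that unfolding independence_system_def system_of_circuits_def
    by (auto dest: subset_trans)
  ultimately show ?thesis
    unfolding contraction_def by blast
qed

lemma circuits_contraction:
  "circuits (contraction M T) = minimal_members {D - T |D. D \<in> circuits M}"
proof -
  have "{D - T |D. D \<in> circuits M} \<subseteq> Pow (ground M - T)"
    by (auto simp: circuits_def minimal_members_def)
  then have "minimal_members {D - T |D. D \<in> circuits M} \<subseteq> Pow (ground M - T)"
    using minimal_members_subset by (rule subset_trans[rotated])
  then show ?thesis
    unfolding contraction_def
    by (rule circuits_system_of_circuits) (rule minimal_members_idem)
qed

lemma column_relation_iff:
  "(\<Sum>j\<in>J. vscale (\<alpha> j) (column G j)) = 0 \<longleftrightarrow> (\<forall>g\<in>set G. (\<Sum>j\<in>J. \<alpha> j * g j) = 0)"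
proof -
  have "(\<Sum>j\<in>J. vscale (\<alpha> j) (column G j)) i =
      (if i < length G then \<Sum>j\<in>J. \<alpha> j * (G ! i) j else 0)" for i
    by (induction J rule: infinite_finite_induct) (auto simp: vscale_def column_def)
  then have "(\<Sum>j\<in>J. vscale (\<alpha> j) (column G j)) = 0 \<longleftrightarrow>
      (\<forall>i<length G. (\<Sum>j\<in>J. \<alpha> j * (G ! i) j) = 0)"
    by (simp add: fun_eq_iff)
  then show ?thesis
    by (simp add: all_set_conv_all_nth)
qed

lemma orthogonal_span:
  assumes "\<forall>g\<in>S. (\<Sum>j\<in>J. \<alpha> j * g j) = 0" "c \<in> module.span vscale S"
  shows "(\<Sum>j\<in>J. \<alpha> j * c j) = (0 :: 'r::comm_ring_1)"
proof -
  interpret module "vscale :: 'r \<Rightarrow> ('a \<Rightarrow> 'r) \<Rightarrow> 'a \<Rightarrow> 'r"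
    by (rule module_vscale)
  have "(\<Sum>j\<in>J. \<alpha> j * (r * x j)) = r * (\<Sum>j\<in>J. \<alpha> j * x j)" for r x
    by (simp add: sum_distrib_left mult.left_commute)
  then have "subspace {c. (\<Sum>j\<in>J. \<alpha> j * c j) = 0}"
    by (auto simp: subspace_def vscale_def distrib_left sum.distrib)
  moreover have "S \<subseteq> {c. (\<Sum>j\<in>J. \<alpha> j * c j) = 0}"
    using assms(1) by blast
  ultimately show ?thesis
    using assms(2) span_minimal by blast
qed

lemma matrix_system_cong:
  assumes "module.span vscale (set G) = module.span vscale (set H)"
  shows "matrix_system E G = matrix_system E H"
proof -
  interpret module "vscale :: 'b \<Rightarrow> ('a \<Rightarrow> 'b) \<Rightarrow> 'a \<Rightarrow> 'b"
    by (rule module_vscale)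
  have "(\<forall>g\<in>set G. (\<Sum>j\<in>J. \<alpha> j * g j) = 0) \<longleftrightarrow> (\<forall>g\<in>set H. (\<Sum>j\<in>J. \<alpha> j * g j) = 0)" for J \<alpha>
    using orthogonal_span[of "set G" \<alpha> J] orthogonal_span[of "set H" \<alpha> J] assms
      span_superset[of "set G"] span_superset[of "set H"] by blast
  then show ?thesis
    by (simp add: matrix_system_def modular_independent_def column_relation_iff)
qed

lemma code_system_eq:
  assumes "generator_matrix C G"
  shows "code_system E C = matrix_system E G"
proof -
  have span: "module.span vscale (set H) = C" if "generator_matrix C H" for H
    using that by (simp add: generator_matrix_def minimal_generating_set_def)
  have "generator_matrix C (SOME G. generator_matrix C G)"
    using assms by (rule someI)
  from span[OF this] span[OF assms] show ?thesis
    unfolding code_system_def by (intro matrix_system_cong) (rule trans[OF _ sym])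
qed

lemma generator_matrix_exists:
  fixes C :: "('e \<Rightarrow> 'r::{comm_ring_1,finite}) set"
  assumes "finite E" "is_code E C"
  shows "\<exists>G. generator_matrix C G"
proof -
  interpret module "vscale :: 'r \<Rightarrow> ('e \<Rightarrow> 'r) \<Rightarrow> 'e \<Rightarrow> 'r"
    by (rule module_vscale)
  have "finite (vecs E :: ('e \<Rightarrow> 'r) set)"
    using finite_set_of_finite_funs[OF assms(1), of "UNIV :: 'r set" 0]
    by (simp add: vecs_def)
  then have "finite C" using assms(2) finite_subset unfolding is_code_def by blast
  moreover have "C \<in> {S. span S = C}"
    using assms(2) unfolding is_code_def by (simp add: span_eq_iff)
  ultimately obtain S where S: "S \<in> minimal_members {S. span S = C}" "S \<subseteq> C"
    using minimal_member_below[of C "{S. span S = C}"] by metis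
  then have "finite S" using \<open>finite C\<close> finite_subset by blast
  then obtain G where "distinct G" "set G = S"
    using finite_distinct_list by blast
  then show ?thesis
    using S(1) by (intro exI[of _ G])
      (auto simp: generator_matrix_def minimal_generating_set_def minimal_members_def)
qed

lemma independence_system_matrix_system:
  assumes "finite E"
  shows "independence_system (matrix_system E G)"
proof -
  have "modular_independent vscale J (column G)"
    if I: "I \<subseteq> E" "modular_independent vscale I (column G)" and J: "J \<subseteq> I" for I J
    unfolding modular_independent_def
  proof (intro allI impI ballI)
    fix \<alpha> j
    assume rel: "(\<Sum>j\<in>J. vscale (\<alpha> j) (column G j)) = 0" and j: "j \<in> J"
    define \<beta> where "\<beta> = (\<lambda>j. if j \<in> J then \<alpha> j else 0)"
    have "(\<Sum>j\<in>I. vscale (\<beta> j) (column G j)) = (\<Sum>j\<in>J. vscale (\<alpha> j) (column G j))"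
      using J finite_subset[OF I(1) assms]
      by (intro sum.mono_neutral_cong_right) (auto simp: \<beta>_def vscale_def fun_eq_iff)
    then have "\<beta> j \<in> max_ideal"
      using rel I(2) j J unfolding modular_independent_def by auto
    then show "\<alpha> j \<in> max_ideal" using j by (simp add: \<beta>_def)
  qed
  moreover have "modular_independent vscale {} (column G)"
    by (simp add: modular_independent_def)
  ultimately show ?thesis
    using assms unfolding independence_system_def matrix_system_def
    by (simp add: Pow_def Collect_mono) (meson subset_trans)
qed

text \<open>The contraction by \<open>{e}\<close> of the system of a code is defined whenever \<open>C\<close> does not
  vanish at \<open>e\<close>.\<close>

lemma singleton_indep_code_system:
  fixes C :: "('e \<Rightarrow> 'r::{comm_ring_1,finite}) set"
  assumes ring: "chain_ring TYPE('r)" "maximal_ideal (I :: 'r set)"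
    and code: "finite E" "is_code E C" and "e \<in> E" "c \<in> C" "pr e c \<noteq> 0"
  shows "{e} \<in> indep (code_system E C)"
proof -
  interpret module "(*) :: 'r \<Rightarrow> 'r \<Rightarrow> 'r" by (rule module_mult)
  obtain G where G: "generator_matrix C G"
    using generator_matrix_exists[OF code] by blast
  then have span_G: "module.span vscale (set G) = C"
    by (simp add: generator_matrix_def minimal_generating_set_def)
  have "\<alpha> e \<in> max_ideal" if rel: "(\<Sum>j\<in>{e}. vscale (\<alpha> j) (column G j)) = 0" for \<alpha>
  proof (rule ccontr)
    assume "\<alpha> e \<notin> max_ideal"
    then have notin: "\<alpha> e \<notin> I" using max_ideal_eq[OF ring] by simp
    have "\<alpha> e \<in> span {\<alpha> e}" by (simp add: span_base)
    moreover have "I \<subseteq> span {\<alpha> e} \<or> span {\<alpha> e} \<subseteq> I"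
      using ring subspace_span[of "{\<alpha> e}"] by (simp add: chain_ring_def maximal_ideal_def)
    moreover have "span {\<alpha> e} = I \<or> span {\<alpha> e} = UNIV" if "I \<subseteq> span {\<alpha> e}"
      using that ring(2) subspace_span[of "{\<alpha> e}"] by (simp add: maximal_ideal_def)
    ultimately have "span {\<alpha> e} = UNIV"
      using notin by blast
    then have "1 \<in> span {\<alpha> e}" by simp
    then obtain k where k: "k * \<alpha> e = 1"
      unfolding span_singleton by (elim rangeE) (rule that, rule sym)
    have "\<forall>g\<in>set G. (\<Sum>j\<in>{e}. \<alpha> j * g j) = 0"
      by (rule iffD1[OF column_relation_iff rel])
    then have "(\<Sum>j\<in>{e}. \<alpha> j * c j) = 0"
      by (rule orthogonal_span) (simp add: span_G \<open>c \<in> C\<close>)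
    then have "\<alpha> e * c e = 0" by simp
    then have "k * \<alpha> e * c e = 0" by (simp only: mult.assoc mult_zero_right)
    then have "c e = 0" by (simp only: k mult_1_left)
    then show False using \<open>pr e c \<noteq> 0\<close> by (simp add: pr_def)
  qed
  then have "modular_independent vscale {e} (column G)"
    unfolding modular_independent_def by blast
  then show ?thesis
    using \<open>e \<in> E\<close> by (simp add: code_system_eq[OF G] matrix_system_def)
qed

end

theory Submission
  imports Defs
begin

text \<open>Let \<open>c\<close> be a codeword whose entry at \<open>e\<close> is \<open>u \<theta>\<^sup>t\<close> and divides all its other entries.
  Any multiple of \<open>c\<close> vanishing at \<open>e\<close> is then zero, so \<open>C\<close> is the direct sum of \<open>R c\<close> and the
  subcode of words vanishing at \<open>e\<close>; this gives the block form and identifies \<open>G\<^sub>0'\<close> as a matrix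
  spanning the shortened code. Since contracting by \<open>e\<close> amounts to testing independence of
  \<open>I \<union> {e}\<close>, it remains to compare relations among the columns: a relation on \<open>I\<close> for \<open>G\<^sub>0'\<close>
  extends to \<open>I \<union> {e}\<close> by solving the first row for the coefficient at \<open>e\<close>, and conversely the
  first row, divided by \<open>\<theta>\<^sup>t\<close>, forces that coefficient into the maximal ideal once the others
  lie there.\<close>

section \<open>Units, annihilators and associates in a chain ring\<close>

interpretation regular: module "(*) :: 'r::comm_ring_1 \<Rightarrow> 'r \<Rightarrow> 'r"
  by (rule module_mult)

interpretation vec: module "vscale :: 'r::comm_ring_1 \<Rightarrow> ('e \<Rightarrow> 'r) \<Rightarrow> 'e \<Rightarrow> 'r"
  by (rule module_vscale)

lemma mem_principal_ideal_iff: "x \<in> \<langle>a\<rangle> \<longleftrightarrow> a dvd x"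
  by (auto simp: regular.span_singleton dvd_def mult.commute)

lemma maximal_ideal_max_ideal:
  assumes "chain_ring TYPE('r::comm_ring_1)" "maximal_ideal (I :: 'r set)"
  shows "maximal_ideal (max_ideal :: 'r set)"
  using assms max_ideal_eq by metis

text \<open>A nonunit generates a proper ideal. Being comparable with \<open>max_ideal\<close>, that
  ideal lies inside it, since only the whole ring is strictly larger.\<close>

lemma mem_max_ideal_iff:
  assumes "chain_ring TYPE('r::comm_ring_1)" "maximal_ideal (I :: 'r set)"
  shows "(x :: 'r) \<in> max_ideal \<longleftrightarrow> \<not> x dvd 1"
proof -
  let ?m = "max_ideal :: 'r set"
  have m: "is_ideal ?m" "?m \<noteq> UNIV"
    "\<And>J. is_ideal J \<Longrightarrow> ?m \<subseteq> J \<Longrightarrow> J = ?m \<or> J = UNIV"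
    using maximal_ideal_max_ideal[OF assms] by (auto simp: maximal_ideal_def)
  show ?thesis
  proof
    assume "x \<in> ?m"
    show "\<not> x dvd 1"
    proof
      assume "x dvd 1"
      have "y \<in> ?m" for y
      proof -
        obtain k where "y = x * k"
          using \<open>x dvd 1\<close> by (meson dvdE dvd_trans one_dvd)
        then show ?thesis
          using regular.subspace_scale[OF m(1) \<open>x \<in> ?m\<close>, of k] by (simp add: mult.commute)
      qed
      then show False using m(2) by blast
    qed
  next
    assume nu: "\<not> x dvd 1"
    have "?m \<subseteq> \<langle>x\<rangle> \<or> \<langle>x\<rangle> \<subseteq> ?m"
      using assms(1) m(1) regular.subspace_span unfolding chain_ring_def by blast
    moreover have "\<langle>x\<rangle> \<noteq> UNIV"
      using nu mem_principal_ideal_iff[of 1 x] by blast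
    ultimately have "\<langle>x\<rangle> \<subseteq> ?m"
      using m(3)[OF regular.subspace_span] by blast
    then show "x \<in> ?m"
      by (simp add: subset_iff mem_principal_ideal_iff)
  qed
qed

text \<open>A unit \<open>x\<close> could be cancelled, giving \<open>a = 0\<close>. This is the
  substitute for dividing a relation by a zero divisor such as a power of
  \<open>\<theta>\<close>.\<close>

lemma annihilator_mem_max_ideal:
  assumes "chain_ring TYPE('r::comm_ring_1)" "maximal_ideal (I :: 'r set)"
    and "a * x = 0" "a \<noteq> (0 :: 'r)"
  shows "x \<in> max_ideal"
  unfolding mem_max_ideal_iff[OF assms(1,2)]
proof
  assume "x dvd 1"
  then have "a * x dvd a * 1" by (rule mult_dvd_mono[OF dvd_refl])
  then show False using assms(3,4) by simp
qed

text \<open>With \<open>b = a * s\<close> and \<open>a = b * r\<close>, the nonzero \<open>a\<close>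
  annihilates \<open>1 - s * r\<close>. This difference is thus a nonunit, which forces
  \<open>s * r\<close>, and so \<open>s\<close>, to be a unit.\<close>

lemma associated_imp_unit_multiple:
  assumes "chain_ring TYPE('r::comm_ring_1)" "maximal_ideal (I :: 'r set)"
    and "a dvd b" "b dvd a" "a \<noteq> (0 :: 'r)"
  shows "\<exists>u. u dvd 1 \<and> b = u * a"
proof -
  let ?m = "max_ideal :: 'r set"
  obtain r s where s: "b = a * s" and r: "a = b * r"
    using assms(3,4) by (auto simp: dvd_def)
  have "a * (s * r) = a"
    unfolding mult.assoc[symmetric] s[symmetric] by (rule r[symmetric])
  then have "a * (1 - s * r) = 0"
    by (simp only: right_diff_distrib mult_1_right diff_self)
  then have "1 - s * r \<in> ?m"
    using annihilator_mem_max_ideal[OF assms(1,2) _ assms(5)] by blast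
  moreover have "1 \<notin> ?m"
    by (simp add: mem_max_ideal_iff[OF assms(1,2)])
  moreover have "is_ideal ?m"
    using maximal_ideal_max_ideal[OF assms(1,2)] by (simp add: maximal_ideal_def)
  ultimately have "s * r \<notin> ?m"
    using regular.subspace_add[of ?m "1 - s * r" "s * r"] by auto
  then have "s dvd 1"
    unfolding mem_max_ideal_iff[OF assms(1,2)] by (auto dest: dvd_mult_left)
  then show ?thesis using s by (auto simp: mult.commute)
qed

section \<open>Independence in a contraction\<close>

text \<open>\<open>D - T\<close> lies inside \<open>I\<close> exactly when \<open>D\<close> lies
  inside \<open>I \<union> T\<close>. Keeping only minimal members is harmless because every subset
  of \<open>I\<close> is finite and so lies above a minimal one.\<close>

lemma indep_contraction_iff:
  assumes M: "independence_system M" and T: "T \<subseteq> ground M"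
  shows "I \<in> indep (contraction M T) \<longleftrightarrow> I \<subseteq> ground M - T \<and> I \<union> T \<in> indep M"
proof -
  let ?F = "{D - T |D. D \<in> circuits M}"
  have "(\<forall>D\<in>minimal_members ?F. \<not> D \<subseteq> I) \<longleftrightarrow> I \<union> T \<in> indep M" if I: "I \<subseteq> ground M - T"
  proof -
    have "finite I"
      using M finite_subset[OF I] by (simp add: independence_system_def)
    have "(\<forall>D\<in>minimal_members ?F. \<not> D \<subseteq> I) \<longleftrightarrow> (\<forall>D\<in>?F. \<not> D \<subseteq> I)"
    proof
      assume *: "\<forall>D\<in>minimal_members ?F. \<not> D \<subseteq> I"
      show "\<forall>D\<in>?F. \<not> D \<subseteq> I"
      proof (intro ballI notI)
        fix D assume D: "D \<in> ?F" "D \<subseteq> I"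
        then show False
          using minimal_member_below[OF finite_subset[OF D(2) \<open>finite I\<close>] D(1)] *
          by (meson subset_trans)
      qed
    next
      assume "\<forall>D\<in>?F. \<not> D \<subseteq> I"
      then show "\<forall>D\<in>minimal_members ?F. \<not> D \<subseteq> I"
        using minimal_members_subset[of ?F] by (meson subsetD)
    qed
    also have "\<dots> \<longleftrightarrow> (\<forall>D\<in>circuits M. \<not> D \<subseteq> I \<union> T)"
      by (auto simp: Diff_subset_conv Un_commute)
    also have "\<dots> \<longleftrightarrow> I \<union> T \<in> indep (system_of_circuits (ground M) (circuits M))"
      using I T by (auto simp: system_of_circuits_def)
    finally show ?thesis
      by (simp add: system_of_circuits_circuits[OF M])
  qed
  then show ?thesis
    by (auto simp: contraction_def system_of_circuits_def)
qed

section \<open>Generating sets with a pivot word\<close>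

lemma vanishing_subspace: "vec.subspace {x. x e = 0}"
  by (simp add: vec.subspace_def vscale_def)

text \<open>The divisibility hypothesis makes \<open>k c\<close> vanish as soon as its entry at \<open>e\<close> does.\<close>

lemma vanishing_part_of_span_insert:
  assumes "\<forall>i. c e dvd c i" and S: "S \<subseteq> {x. x e = 0}"
  shows "{x \<in> vec.span (insert c S). x e = 0} = vec.span S"
proof (intro equalityI subsetI)
  fix x assume x: "x \<in> {x \<in> vec.span (insert c S). x e = 0}"
  then obtain k where k: "x - vscale k c \<in> vec.span S"
    by (auto simp: vec.span_breakdown_eq)
  have "(x - vscale k c) e = 0"
    using k vec.span_minimal[OF S vanishing_subspace] by blast
  with x have ke: "k * c e = 0" by (simp add: vscale_def)
  have "k * c i = 0" for i
  proof -
    obtain b where "c i = c e * b" using assms(1) by (auto simp: dvd_def)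
    then show ?thesis using ke by (simp flip: mult.assoc)
  qed
  then have "vscale k c = 0" by (simp add: vscale_def fun_eq_iff)
  then show "x \<in> vec.span S" using k by simp
next
  fix x assume "x \<in> vec.span S"
  then show "x \<in> {x \<in> vec.span (insert c S). x e = 0}"
    using vec.span_minimal[OF S vanishing_subspace] vec.span_mono[of S "insert c S"] by blast
qed

text \<open>Subtracting a suitable multiple of \<open>c\<close> clears the entry of a codeword at
  \<open>e\<close>.\<close>

lemma span_insert_pivot:
  assumes C: "vec.subspace C" and c: "c \<in> C" and dvd: "\<forall>x\<in>C. c e dvd x e"
    and S: "vec.span S = {x \<in> C. x e = 0}"
  shows "vec.span (insert c S) = C"
proof
  have "S \<subseteq> C" using vec.span_superset[of S] S by blast
  then show "vec.span (insert c S) \<subseteq> C"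
    using c by (intro vec.span_minimal[OF _ C]) auto
next
  show "C \<subseteq> vec.span (insert c S)"
  proof
    fix x assume x: "x \<in> C"
    obtain k where "x e = c e * k" using dvd x by (auto simp: dvd_def)
    then have "x - vscale k c \<in> vec.span S"
      unfolding S using vec.subspace_diff[OF C x vec.subspace_scale[OF C c]]
      by (simp add: vscale_def mult.commute)
    then show "x \<in> vec.span (insert c S)"
      by (auto simp: vec.span_breakdown_eq)
  qed
qed

text \<open>Minimality: a smaller generating set without \<open>c\<close> would make all of
  \<open>C\<close> vanish at \<open>e\<close>. One with \<open>c\<close> would, after removing
  \<open>c\<close>, generate the vanishing words with fewer rows than \<open>H\<close>.\<close>

lemma generator_matrix_Cons_pivot:
  assumes C: "vec.subspace C" and c: "c \<in> C" "c e \<noteq> 0"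
    and dvd: "\<forall>x\<in>C. c e dvd x e" "\<forall>i. c e dvd c i"
    and H: "generator_matrix {x \<in> C. x e = 0} H"
  shows "generator_matrix C (c # H)"
proof -
  let ?K = "{x \<in> C. x e = 0}"
  have span: "vec.span (set H) = ?K" and dist: "distinct H"
    and min: "\<And>S. S \<subset> set H \<Longrightarrow> vec.span S \<noteq> ?K"
    using H by (auto simp: generator_matrix_def minimal_generating_set_def)
  have HK: "set H \<subseteq> ?K" using vec.span_superset[of "set H"] span by blast
  have "vec.span S \<noteq> C" if S: "S \<subset> insert c (set H)" for S
  proof
    assume eq: "vec.span S = C"
    show False
    proof (cases "c \<in> S")
      case True
      define S' where "S' = S - {c}"
      have ins: "insert c S' = S" using True by (auto simp: S'_def)
      have S': "S' \<subset> set H" using S True unfolding S'_def by blast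
      then have "S' \<subseteq> {x. x e = 0}" using HK by blast
      from vanishing_part_of_span_insert[OF dvd(2) this]
      have "vec.span S' = ?K" by (simp add: ins eq)
      then show False using min[OF S'] by blast
    next
      case False
      then have "S \<subseteq> {x. x e = 0}" using S HK by blast
      then have "C \<subseteq> {x. x e = 0}"
        unfolding eq[symmetric] by (rule vec.span_minimal[OF _ vanishing_subspace])
      then show False using c by blast
    qed
  qed
  moreover have "vec.span (insert c (set H)) = C"
    by (rule span_insert_pivot[OF C c(1) dvd(1) span])
  ultimately show ?thesis
    using dist HK c(2) by (auto simp: generator_matrix_def minimal_generating_set_def)
qed

section \<open>The shortened code and block matrices\<close>

lemma shortened_singleton:
  assumes "C \<subseteq> vecs E"
  shows "shortened E C {e} = {x \<in> C. x e = 0}"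
proof -
  have "vrestrict (E - {e}) x = x" if "x \<in> C" "x e = 0" for x
    using that assms by (auto simp: vrestrict_def vecs_def fun_eq_iff)
  then show ?thesis by (auto simp: shortened_def)
qed

lemma is_code_vanishing:
  assumes "is_code E C"
  shows "is_code (E - {e}) {x \<in> C. x e = 0}"
proof -
  have "{x \<in> C. x e = 0} = C \<inter> {x. x e = 0}" by blast
  then have "vec.subspace {x \<in> C. x e = 0}"
    using assms vec.subspace_inter[OF _ vanishing_subspace, of C e] unfolding is_code_def by metis
  then show ?thesis
    using assms by (auto simp: is_code_def vecs_def)
qed

text \<open>A matrix system depends only on the row span, so a spanning list of rows can stand in
  for a generator matrix. For the lower block of a pivot form, only its span then has to be
  found.\<close>

lemma code_system_span:
  fixes C :: "('e \<Rightarrow> 'r::{comm_ring_1,finite}) set"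
  assumes "finite E" "is_code E C" "vec.span (set G) = C"
  shows "code_system E C = matrix_system E G"
proof -
  obtain H where H: "generator_matrix C H"
    using generator_matrix_exists[OF assms(1,2)] by blast
  then have "vec.span (set H) = vec.span (set G)"
    using assms(3) by (simp add: generator_matrix_def minimal_generating_set_def)
  then show ?thesis
    using code_system_eq[OF H] matrix_system_cong by metis
qed

lemma block_matrix_eq_Cons:
  assumes "set G' \<subseteq> vecs (E - {e})"
  shows "block_matrix e p a G' = a(e := p) # G'"
proof -
  have "map (\<lambda>g. g(e := 0)) G' = map id G'"
    using assms by (intro map_cong) (auto simp: vecs_def fun_eq_iff)
  then show ?thesis by (simp add: block_matrix_def)
qed

section \<open>Column relations and contraction by the pivot column\<close>

lemma modular_independent_insert_pivot:
  assumes ring: "chain_ring TYPE('r::comm_ring_1)" "maximal_ideal (J :: 'r set)"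
    and I: "finite I" "e \<notin> I"
    and H: "\<forall>g\<in>set H. g e = 0"
    and c: "c e \<noteq> (0 :: 'r)" "\<forall>i. c e dvd c i"
  shows "modular_independent vscale (insert e I) (column (c # H)) \<longleftrightarrow>
    modular_independent vscale I (column H)"
proof -
  let ?m = "max_ideal :: 'r set"
  define rel where "rel \<alpha> \<longleftrightarrow> (\<forall>g\<in>set H. (\<Sum>j\<in>I. \<alpha> j * g j) = 0)" for \<alpha> :: "'a \<Rightarrow> 'r"
  \<comment> \<open>\<open>b\<close> is the first row divided by its pivot; the quotients need not
    be unique, and any choice serves.\<close>
  obtain b where b: "\<And>i. c i = c e * b i"
    using c(2) unfolding dvd_def by metis
  have row: "(\<Sum>j\<in>insert e I. \<alpha> j * c j) = c e * (\<alpha> e + (\<Sum>j\<in>I. \<alpha> j * b j))" for \<alpha>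
  proof -
    have "(\<Sum>j\<in>I. \<alpha> j * c j) = c e * (\<Sum>j\<in>I. \<alpha> j * b j)"
      unfolding sum_distrib_left by (intro sum.cong refl, subst b) (rule mult.left_commute)
    then show ?thesis using I by (simp add: distrib_left mult.commute)
  qed
  have relation: "(\<Sum>j\<in>insert e I. vscale (\<alpha> j) (column (c # H) j)) = 0 \<longleftrightarrow>
      c e * (\<alpha> e + (\<Sum>j\<in>I. \<alpha> j * b j)) = 0 \<and> rel \<alpha>" for \<alpha>
  proof -
    have "(\<Sum>j\<in>insert e I. \<alpha> j * g j) = (\<Sum>j\<in>I. \<alpha> j * g j)" if "g \<in> set H" for g
      using I bspec[OF H that] by simp
    then show ?thesis
      unfolding column_relation_iff rel_def row[symmetric] by simp
  qed
  have ideal: "is_ideal ?m"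
    using maximal_ideal_max_ideal[OF ring] by (simp add: maximal_ideal_def)
  show ?thesis
  proof
    assume ind: "modular_independent vscale (insert e I) (column (c # H))"
    show "modular_independent vscale I (column H)"
      unfolding modular_independent_def column_relation_iff
    proof (intro allI impI ballI)
      fix \<alpha> j assume \<alpha>: "\<forall>g\<in>set H. (\<Sum>j\<in>I. \<alpha> j * g j) = 0" and j: "j \<in> I"
      \<comment> \<open>The coefficient at \<open>e\<close> is chosen to make the first row's
        bracket vanish; the other rows do not see it, being zero at \<open>e\<close>.\<close>
      define \<beta> where "\<beta> = \<alpha>(e := - (\<Sum>j\<in>I. \<alpha> j * b j))"
      have eq: "(\<Sum>j\<in>I. \<beta> j * f j) = (\<Sum>j\<in>I. \<alpha> j * f j)" for f
        using I by (intro sum.cong) (auto simp: \<beta>_def)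
      have "\<beta> e + (\<Sum>j\<in>I. \<beta> j * b j) = 0"
        unfolding eq by (simp add: \<beta>_def)
      then have "(\<Sum>j\<in>insert e I. vscale (\<beta> j) (column (c # H) j)) = 0"
        unfolding relation rel_def eq using \<alpha> by simp
      then have "\<beta> j \<in> ?m"
        using ind j unfolding modular_independent_def by blast
      moreover have "\<beta> j = \<alpha> j" using I j by (auto simp: \<beta>_def)
      ultimately show "\<alpha> j \<in> ?m" by simp
    qed
  next
    assume ind: "modular_independent vscale I (column H)"
    show "modular_independent vscale (insert e I) (column (c # H))"
      unfolding modular_independent_def relation
    proof (intro allI impI)
      fix \<alpha> assume \<alpha>: "c e * (\<alpha> e + (\<Sum>j\<in>I. \<alpha> j * b j)) = 0 \<and> rel \<alpha>"
      then have mem: "\<alpha> j \<in> ?m" if "j \<in> I" for j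
        using ind that unfolding modular_independent_def column_relation_iff rel_def by blast
      \<comment> \<open>As \<open>c e\<close> may be a zero divisor, the bracket need not vanish,
        but membership in the maximal ideal is enough.\<close>
      have "\<alpha> e + (\<Sum>j\<in>I. \<alpha> j * b j) \<in> ?m"
        using annihilator_mem_max_ideal[OF ring _ c(1)] \<alpha> by blast
      moreover have "(\<Sum>j\<in>I. \<alpha> j * b j) \<in> ?m"
        using regular.subspace_scale[OF ideal mem]
        by (intro regular.subspace_sum[OF ideal]) (metis mult.commute)
      ultimately have "\<alpha> e \<in> ?m"
        using regular.subspace_diff[OF ideal] by (metis add_diff_cancel_right')
      then show "\<forall>j\<in>insert e I. \<alpha> j \<in> ?m" using mem by blast
    qed
  qed
qed

lemma contraction_matrix_system_pivot:
  assumes ring: "chain_ring TYPE('r::comm_ring_1)" "maximal_ideal (J :: 'r set)"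
    and E: "finite E" "e \<in> E"
    and H: "\<forall>g\<in>set H. g e = 0"
    and c: "c e \<noteq> (0 :: 'r)" "\<forall>i. c e dvd c i"
  shows "contraction (matrix_system E (c # H)) {e} = matrix_system (E - {e}) H"
proof (rule indep_system.equality)
  show "ground (contraction (matrix_system E (c # H)) {e}) = ground (matrix_system (E - {e}) H)"
    by (simp add: contraction_def system_of_circuits_def matrix_system_def)
next
  have "I \<in> indep (contraction (matrix_system E (c # H)) {e}) \<longleftrightarrow>
      I \<in> indep (matrix_system (E - {e}) H)" for I
  proof (cases "I \<subseteq> E - {e}")
    case True
    then have "finite I" "e \<notin> I" using E(1) finite_subset by blast+
    from modular_independent_insert_pivot[OF ring this H c] True E show ?thesis
      by (subst indep_contraction_iff[OF independence_system_matrix_system])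
        (auto simp: matrix_system_def)
  next
    case False
    then show ?thesis
      by (simp add: contraction_def system_of_circuits_def matrix_system_def)
  qed
  then show "indep (contraction (matrix_system E (c # H)) {e}) =
      indep (matrix_system (E - {e}) H)" by blast
qed simp

theorem theorem4p12:
  fixes \<theta> :: "'r::{comm_ring_1,finite}" and \<nu> t :: nat
    and E :: "'e set" and C :: "('e \<Rightarrow> 'r) set" and e :: 'e
  assumes "chain_ring TYPE('r)"
    and "maximal_ideal \<langle>\<theta>\<rangle>"
    and "\<nu> = nilpotency_index \<theta>"
    and "finite E"
    and "is_code E C"
    and "e \<in> E"
    and "contractible \<theta> E C e"
    and "pr e ` C = \<langle>\<theta> ^ t\<rangle>"
    and "t < \<nu>"
  shows "(\<exists>G\<^sub>0 G\<^sub>0'. generator_matrix C G\<^sub>0 \<and> pivot_form \<theta> t E e G\<^sub>0 G\<^sub>0') \<and>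
    (\<forall>G\<^sub>0 G\<^sub>0'. generator_matrix C G\<^sub>0 \<and> pivot_form \<theta> t E e G\<^sub>0 G\<^sub>0' \<longrightarrow>
       code_system (E - {e}) (shortened E C {e}) = matrix_system (E - {e}) G\<^sub>0' \<and>
       matrix_system (E - {e}) G\<^sub>0' = contraction (code_system E C) {e})"
proof -
  note ring = assms(1,2)
  let ?K = "{x \<in> C. x e = 0}"
  have C: "C \<subseteq> vecs E" "vec.subspace C" using assms(5) by (auto simp: is_code_def)
  have K: "is_code (E - {e}) ?K" by (rule is_code_vanishing[OF assms(5)])
  \<comment> \<open>\<open>t\<close> lies below the least exponent at which the powers of
    \<open>\<theta>\<close> vanish.\<close>
  have nz: "\<theta> ^ t \<noteq> 0"
    using not_less_Least[of t "\<lambda>n. \<theta> ^ n = 0"] assms(3,9) by (simp add: nilpotency_index_def)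
  have pivot_dvd: "u * \<theta> ^ t dvd x" if "u dvd 1" "\<theta> ^ t dvd x" for u x
    using mult_dvd_mono[OF that] by simp
  have pivot_nz: "u * \<theta> ^ t \<noteq> 0" if "u dvd 1" for u
    using pivot_dvd[OF that dvd_refl] nz by auto
  have "\<exists>G\<^sub>0 G\<^sub>0'. generator_matrix C G\<^sub>0 \<and> pivot_form \<theta> t E e G\<^sub>0 G\<^sub>0'"
  proof -
    \<comment> \<open>The exponent \<open>s\<close> provided by contractibility is not known to equal \<open>t\<close>; only the ideals agree.\<close>
    obtain s c u where s: "pr e ` C = \<langle>\<theta> ^ s\<rangle>" and c: "c \<in> C"
      and u: "u dvd 1" "c e = u * \<theta> ^ s" and cE: "\<forall>i\<in>E. c i \<in> \<langle>\<theta> ^ s\<rangle>"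
      using assms(7) unfolding contractible_def by (elim conjE exE bexE)
    have ideals: "\<langle>\<theta> ^ s\<rangle> = \<langle>\<theta> ^ t\<rangle>" using s assms(8) by simp
    then have "\<theta> ^ s dvd \<theta> ^ t" "\<theta> ^ t dvd \<theta> ^ s"
      by (metis mem_principal_ideal_iff dvd_refl)+
    then obtain w where w: "w dvd 1" "\<theta> ^ s = w * \<theta> ^ t"
      using associated_imp_unit_multiple[OF ring _ _ nz] by blast
    have uw: "u * w dvd 1" using mult_dvd_mono[OF u(1) w(1)] by simp
    have ce: "c e = u * w * \<theta> ^ t" by (simp only: u(2) w(2) mult.assoc)
    have c_dvd: "\<forall>i. c e dvd c i"
    proof
      fix i show "c e dvd c i"
      proof (cases "i \<in> E")
        case True
        then have "\<theta> ^ t dvd c i"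
          using cE by (simp only: ideals mem_principal_ideal_iff)
        then show ?thesis
          unfolding ce by (rule pivot_dvd[OF uw])
      next
        case False
        \<comment> \<open>Outside \<open>E\<close> a codeword is represented by zeros, which
          everything divides.\<close>
        then show ?thesis using c C(1) by (auto simp: vecs_def)
      qed
    qed
    have C_dvd: "\<forall>x\<in>C. c e dvd x e"
    proof
      fix x assume "x \<in> C"
      then have "x e \<in> \<langle>\<theta> ^ t\<rangle>" using assms(8) by (auto simp: pr_def)
      then show "c e dvd x e"
        unfolding ce mem_principal_ideal_iff by (rule pivot_dvd[OF uw])
    qed
    obtain H where H: "generator_matrix ?K H"
      using generator_matrix_exists[OF _ K] assms(4) by blast
    then have "set H \<subseteq> ?K"
      using vec.span_superset[of "set H"]
      by (simp add: generator_matrix_def minimal_generating_set_def)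
    then have HE: "set H \<subseteq> vecs (E - {e})" using K by (auto simp: is_code_def)
    have "c e \<noteq> 0" unfolding ce by (rule pivot_nz[OF uw])
    then have "generator_matrix C (c # H)"
      by (rule generator_matrix_Cons_pivot[OF C(2) c _ C_dvd c_dvd H])
    moreover have "pivot_form \<theta> t E e (c # H) H"
      unfolding pivot_form_def
    proof (intro conjI exI)
      show "u * w dvd 1" by (rule uw)
      show "c(e := 0) \<in> vecs (E - {e})" using c C(1) by (auto simp: vecs_def)
      show "\<forall>i\<in>E - {e}. (c(e := 0)) i \<in> \<langle>\<theta> ^ t\<rangle>" using cE ideals by simp
      \<comment> \<open>Writing the pivot value back into \<open>c(e := 0)\<close> restores
        \<open>c\<close>.\<close>
      show "c # H = block_matrix e (u * w * \<theta> ^ t) (c(e := 0)) H"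
        unfolding block_matrix_eq_Cons[OF HE] by (simp flip: ce)
    qed (rule HE)
    ultimately show ?thesis by blast
  qed
  moreover have "code_system (E - {e}) (shortened E C {e}) = matrix_system (E - {e}) H \<and>
       matrix_system (E - {e}) H = contraction (code_system E C) {e}"
    if G: "generator_matrix C G" and piv: "pivot_form \<theta> t E e G H" for G H
  proof -
    obtain u a where HE: "set H \<subseteq> vecs (E - {e})" and u: "u dvd 1"
      and a: "a \<in> vecs (E - {e})" "\<And>i. i \<in> E - {e} \<Longrightarrow> a i \<in> \<langle>\<theta> ^ t\<rangle>"
      and blk: "G = block_matrix e (u * \<theta> ^ t) a H"
      using piv unfolding pivot_form_def by blast
    define c where "c = a(e := u * \<theta> ^ t)"
    have Gc: "G = c # H" by (simp add: blk block_matrix_eq_Cons[OF HE] c_def)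
    have c_nz: "c e \<noteq> 0" using pivot_nz[OF u] by (simp add: c_def)
    have c_dvd: "\<forall>i. c e dvd c i"
    proof
      fix i show "c e dvd c i"
      proof (cases "i \<in> E - {e}")
        case True
        then show ?thesis
          using pivot_dvd[OF u] a(2) by (simp add: c_def mem_principal_ideal_iff)
      next
        case False
        \<comment> \<open>Either \<open>i = e\<close>, and the entry is the pivot itself, or
          \<open>i\<close> is outside \<open>E\<close>, and the entry is zero.\<close>
        then show ?thesis using a(1) by (auto simp: c_def vecs_def)
      qed
    qed
    have He: "\<forall>g\<in>set H. g e = 0" using HE by (auto simp: vecs_def)
    have span: "vec.span (insert c (set H)) = C"
      using G by (simp add: Gc generator_matrix_def minimal_generating_set_def)
    \<comment> \<open>The first row contributes nothing to the words of \<open>C\<close> vanishing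
      at \<open>e\<close>, so the lower rows alone span them.\<close>
    have "vec.span (set H) = ?K"
      using vanishing_part_of_span_insert[OF c_dvd, of "set H"] He by (auto simp: span)
    then have "code_system (E - {e}) (shortened E C {e}) = matrix_system (E - {e}) H"
      using code_system_span[OF _ K] assms(4) by (simp add: shortened_singleton[OF C(1)])
    moreover have "contraction (code_system E C) {e} = matrix_system (E - {e}) H"
      unfolding code_system_eq[OF G] Gc
      by (rule contraction_matrix_system_pivot[OF ring assms(4,6) He c_nz c_dvd])
    ultimately show ?thesis by simp
  qed
  ultimately show ?thesis by blast
qed

end
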